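(* Let $L>0$, let $[t_0,t_1]\subseteq[-L,L]$, let $k\in\mathbb N=\{1,2,\ldots\}$, and write $$\omega_{k,L}:=\frac{k\pi}{2L},\qquad \phi_{k,L}(t)=L^{-1/2}\sin\bigl(\omega_{k,L}(t+L)\bigr).$$ For every $m\in\mathbb Z$, the transformed function $\psi_k^{[m]}(t):=(\mathcal A_{t_0}^{[m]}\phi_{k,L})(t)$, $t\in[t_0,t_1]$, is given as follows. If $m\le0$, $$\psi_k^{[m]}(t)=L^{-1/2}\omega_{k,L}^{-m}\sin\bigl(\omega_{k,L}(t+L)-m\pi/2\bigr).$$ If $m=1$, $$\psi_k^{[1]}(t)=\frac{L^{-1/2}}{\omega_{k,L}}\left[\cos\bigl(\omega_{k,L}(t_0+L)\bigr)-\cos\bigl(\omega_{k,L}(t+L)\bigr)\right].$$ If $m=2,3,\ldots$, $$\psi_k^{[m]}(t)=\frac{(t-t_0)^{m-1}L^{-1/2}}{(m-1)!\,\omega_{k,L}}\cos\bigl(\omega_{k,L}(t_0+L)\bigr)+\frac{(t-t_0)^{m-2}L^{-1/2}}{(m-2)!\,\omega_{k,L}^{2}}\sin\bigl(\omega_{k,L}(t_0+L)\bigr)-\omega_{k,L}^{-2}\psi_k^{[m-2]}(t).$$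
   Context: For $q>0$, $(\mathcal I_{t_0}^q f)(t)=\frac{1}{(q-1)!}\int_{t_0}^t(t-u)^{q-1}f(u)\,du$. The signed-order operator is $\mathcal A_{t_0}^{[m]}=D_t^{-m}$ (the ordinary $(-m)$th derivative) for $m<0$, $\mathrm{Id}$ for $m=0$, and $\mathcal I_{t_0}^m$ for $m>0$. Convention: $(t-t_0)^0=1$. *)

theory Defs
  imports "HOL-Analysis.Analysis"
begin

definition \<omega> :: "nat \<Rightarrow> real \<Rightarrow> real" where
  "\<omega> k L = real k * pi / (2 * L)"

(* The defining formula makes sense on all of \<real>, so deriv below is the two-sided derivative, also
   at the end points of an interval. *)
definition \<phi> :: "nat \<Rightarrow> real \<Rightarrow> real \<Rightarrow> real" where
  "\<phi> k L t = L powr (-1/2) * sin (\<omega> k L * (t + L))"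

(* Meant for q > 0 only. *)
definition iterated_integral :: "real \<Rightarrow> nat \<Rightarrow> (real \<Rightarrow> real) \<Rightarrow> real \<Rightarrow> real" where
  "iterated_integral t0 q f t = 1 / fact (q - 1) * (LBINT u=t0..t. (t - u) ^ (q - 1) * f u)"

definition signed_order_op :: "real \<Rightarrow> int \<Rightarrow> (real \<Rightarrow> real) \<Rightarrow> real \<Rightarrow> real" where
  "signed_order_op t0 m f =
     (if m < 0 then (deriv ^^ nat (- m)) f
      else if m = 0 then f
      else iterated_integral t0 (nat m) f)"

definition \<psi> :: "nat \<Rightarrow> real \<Rightarrow> real \<Rightarrow> int \<Rightarrow> real \<Rightarrow> real" where
  "\<psi> k L t0 m t = signed_order_op t0 m (\<phi> k L) t"

end

theory Submission
  imports Defs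
begin

text \<open>
  For \<open>m \<le> 0\<close> each derivative shifts the phase of the sine by \<open>\<pi>/2\<close> and contributes a factor
  \<open>\<omega>\<close>. For \<open>m > 0\<close>, integrating \<open>(t - u)^n sin (a (u + L))\<close> by parts twice lowers \<open>n\<close> by two;
  both steps at once are seen by differentiating
  \<open>- (t - u)^n cos (a (u + L)) / a - n (t - u)^(n-1) sin (a (u + L)) / a\<^sup>2\<close> in \<open>u\<close>.
\<close>

lemma higher_deriv_sin_affine:
  fixes C a b :: real
  shows "(deriv ^^ n) (\<lambda>t. C * sin (a * (t + b)))
    = (\<lambda>t. C * a ^ n * sin (a * (t + b) + real n * pi / 2))"
proof (induction n)
  case 0
  show ?case by simp
next
  case (Suc n)
  have "deriv (\<lambda>t. C * a ^ n * sin (a * (t + b) + real n * pi / 2)) t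
      = C * a ^ Suc n * sin (a * (t + b) + real (Suc n) * pi / 2)" for t
  proof (rule DERIV_imp_deriv)
    have "sin (a * (t + b) + real (Suc n) * pi / 2) = sin ((a * (t + b) + real n * pi / 2) + pi / 2)"
      by (simp add: field_simps)
    also have "\<dots> = cos (a * (t + b) + real n * pi / 2)"
      by (simp add: sin_add)
    finally show "((\<lambda>t. C * a ^ n * sin (a * (t + b) + real n * pi / 2)) has_real_derivative
        C * a ^ Suc n * sin (a * (t + b) + real (Suc n) * pi / 2)) (at t)"
      by (auto intro!: derivative_eq_intros)
  qed
  then show ?case by (simp add: Suc.IH fun_eq_iff)
qed

text \<open>Where an exponent truncates (\<open>n \<le> 1\<close>), its coefficient vanishes.\<close>

lemma integral_power_sin_step:
  fixes a b s t :: real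
  assumes "a \<noteq> 0"
  shows "(LBINT u=s..t. (t - u) ^ n * sin (a * (u + b)))
    = (t - s) ^ n * cos (a * (s + b)) / a + real n * (t - s) ^ (n - 1) * sin (a * (s + b)) / a\<^sup>2
      - 0 ^ n * cos (a * (t + b)) / a - real n * 0 ^ (n - 1) * sin (a * (t + b)) / a\<^sup>2
      - real n * real (n - 1) / a\<^sup>2 * (LBINT u=s..t. (t - u) ^ (n - 2) * sin (a * (u + b)))"
proof -
  define f where "f k u = (t - u) ^ k * sin (a * (u + b))" for k u
  define F where
    "F u = - ((t - u) ^ n * cos (a * (u + b)) / a) - real n * (t - u) ^ (n - 1) * sin (a * (u + b)) / a\<^sup>2"
    for u
  define c where "c = real n * real (n - 1) / a\<^sup>2"
  have f_cont: "continuous_on A (f k)" for A k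
    unfolding f_def by (intro continuous_intros)
  have f_int: "interval_lebesgue_integrable lborel (ereal s) (ereal t) (f k)" for k
    by (rule interval_integrable_isCont) (use f_cont[of UNIV k] in \<open>simp add: continuous_on_eq_continuous_at\<close>)
  have pow: "((\<lambda>u. (t - u) ^ k) has_real_derivative - (real k * (t - u) ^ (k - 1))) (at u within A)"
    for k u A
    by (auto intro!: derivative_eq_intros)
  have sin: "((\<lambda>u. sin (a * (u + b))) has_real_derivative a * cos (a * (u + b))) (at u within A)"
    and cos: "((\<lambda>u. cos (a * (u + b))) has_real_derivative - (a * sin (a * (u + b)))) (at u within A)"
    for u A
    by (auto intro!: derivative_eq_intros)
  \<comment> \<open>Differentiating the power in the cosine term and the sine in the other term
    gives two cosine contributions that cancel; the correction left over is the sine with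
    coefficient \<open>c\<close>.\<close>
  have "(F has_real_derivative f n u + c * f (n - 2) u) (at u within A)" for u A
  proof -
    \<comment> \<open>Named powers reduce the cancellation to plain field arithmetic, without case
      splits on truncated exponents. The exponent \<open>n - 1 - 1\<close> is the one that
      \<open>pow\<close> produces at \<open>n - 1\<close>.\<close>
    define p q r where "p = (t - u) ^ n" and "q = (t - u) ^ (n - 1)" and "r = (t - u) ^ (n - 1 - 1)"
    define S K where "S = sin (a * (u + b))" and "K = cos (a * (u + b))"
    have "(F has_real_derivative - ((- (real n * q) * K + - (a * S) * p) / a)
        - ((real n * - (real (n - 1) * r)) * S + (a * K) * (real n * q)) / a\<^sup>2) (at u within A)"
      unfolding F_def p_def q_def r_def S_def K_def
      by (rule DERIV_diff DERIV_minus DERIV_cdivide DERIV_cmult DERIV_mult pow sin cos)+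
    moreover have "- ((- (real n * q) * K + - (a * S) * p) / a)
        - ((real n * - (real (n - 1) * r)) * S + (a * K) * (real n * q)) / a\<^sup>2
      = p * S + real n * real (n - 1) / a\<^sup>2 * (r * S)"
      using assms by (simp add: add_divide_distrib diff_divide_distrib power2_eq_square)
    ultimately show ?thesis
      unfolding f_def c_def p_def q_def r_def S_def K_def by (simp add: numeral_2_eq_2)
  qed
  then have "(LBINT u=s..t. f n u + c * f (n - 2) u) = F t - F s"
    by (intro interval_integral_FTC_finite continuous_intros f_cont)
       (simp flip: has_real_derivative_iff_has_vector_derivative)
  also have "(LBINT u=s..t. f n u + c * f (n - 2) u)
      = (LBINT u=s..t. f n u) + c * (LBINT u=s..t. f (n - 2) u)"
    by (subst interval_lebesgue_integral_add) (auto intro: f_int)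
  \<comment> \<open>The powers of 0 are the boundary values at \<open>u = t\<close>. As
    \<open>0 ^ 0 = 1\<close>, the cosine survives there only for \<open>n = 0\<close> and the sine
    only for \<open>n = 1\<close>.\<close>
  finally show ?thesis
    unfolding F_def f_def c_def by simp
qed

text \<open>Taking the order as \<open>Suc n\<close> turns the kernel exponent into
  \<open>n\<close>, so that \<open>integral_power_sin_step\<close> applies directly.\<close>

lemma iterated_integral_\<phi>:
  "iterated_integral t0 (Suc n) (\<phi> k L) t
    = L powr (-1/2) / fact n * (LBINT u=t0..t. (t - u) ^ n * sin (\<omega> k L * (u + L)))"
proof -
  have "(LBINT u=t0..t. (t - u) ^ n * \<phi> k L u)
      = (LBINT u=t0..t. L powr (-1/2) * ((t - u) ^ n * sin (\<omega> k L * (u + L))))"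
    unfolding \<phi>_def by (intro arg_cong[where f = "interval_lebesgue_integral _ _ _"]) (auto simp: ac_simps)
  then show ?thesis
    by (simp add: iterated_integral_def)
qed

lemma \<psi>_nonpos:
  "\<psi> k L t0 (- int n) t
    = L powr (-1/2) * \<omega> k L ^ n * sin (\<omega> k L * (t + L) + real n * pi / 2)"
proof -
  have "\<psi> k L t0 (- int n) t = (deriv ^^ n) (\<phi> k L) t"
    by (simp add: \<psi>_def signed_order_op_def)
  moreover have "\<phi> k L = (\<lambda>t. L powr (-1/2) * sin (\<omega> k L * (t + L)))"
    by (simp add: fun_eq_iff \<phi>_def)
  ultimately show ?thesis
    by (simp add: higher_deriv_sin_affine)
qed

lemma \<psi>_pos:
  "\<psi> k L t0 (int (Suc n)) t
    = L powr (-1/2) / fact n * (LBINT u=t0..t. (t - u) ^ n * sin (\<omega> k L * (u + L)))"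
  unfolding iterated_integral_\<phi>[symmetric] by (simp add: \<psi>_def signed_order_op_def nat_add_distrib)

lemma \<psi>_one:
  assumes "\<omega> k L \<noteq> 0"
  shows "\<psi> k L t0 1 t
    = L powr (-1/2) / \<omega> k L * (cos (\<omega> k L * (t0 + L)) - cos (\<omega> k L * (t + L)))"
proof -
  have "\<psi> k L t0 1 t = L powr (-1/2) * (LBINT u=t0..t. sin (\<omega> k L * (u + L)))"
    using \<psi>_pos[of k L t0 0 t] by simp
  also have "(LBINT u=t0..t. sin (\<omega> k L * (u + L)))
      = cos (\<omega> k L * (t0 + L)) / \<omega> k L - cos (\<omega> k L * (t + L)) / \<omega> k L"
    using integral_power_sin_step[OF assms, of t0 t 0 L] by simp
  finally show ?thesis
    by (simp add: diff_divide_distrib right_diff_distrib)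
qed

text \<open>This is \<open>integral_power_sin_step\<close> with exponent \<open>n + 1\<close>,
  divided by \<open>fact (n + 1)\<close>. For \<open>n > 0\<close> the coefficient
  \<open>(n + 1) * n\<close> of the remaining integral leaves \<open>1 / fact (n - 1)\<close>, the
  normalisation of order \<open>n\<close>. For \<open>n = 0\<close> that integral disappears, and
  the term of order 0 has to come from elsewhere.\<close>

lemma \<psi>_recurrence:
  assumes w: "\<omega> k L \<noteq> 0"
  shows "\<psi> k L t0 (int (n + 2)) t
    = (t - t0) ^ (n + 1) * L powr (-1/2) / (fact (n + 1) * \<omega> k L) * cos (\<omega> k L * (t0 + L))
      + (t - t0) ^ n * L powr (-1/2) / (fact n * (\<omega> k L)\<^sup>2) * sin (\<omega> k L * (t0 + L))
      - \<psi> k L t0 (int n) t / (\<omega> k L)\<^sup>2"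
proof (cases n)
  case 0
  have "\<psi> k L t0 0 t = L powr (-1/2) * sin (\<omega> k L * (t + L))"
    by (simp add: \<psi>_def signed_order_op_def \<phi>_def)
  moreover have "\<psi> k L t0 2 t = L powr (-1/2) * (LBINT u=t0..t. (t - u) * sin (\<omega> k L * (u + L)))"
    using \<psi>_pos[of k L t0 1 t] by simp
  \<comment> \<open>The last sine is the surviving boundary term at \<open>u = t\<close>; up to the
    factor \<open>L powr (-1/2)\<close> it supplies the term of order 0.\<close>
  moreover have "(LBINT u=t0..t. (t - u) * sin (\<omega> k L * (u + L)))
      = (t - t0) * cos (\<omega> k L * (t0 + L)) / \<omega> k L + sin (\<omega> k L * (t0 + L)) / (\<omega> k L)\<^sup>2
        - sin (\<omega> k L * (t + L)) / (\<omega> k L)\<^sup>2"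
    using integral_power_sin_step[OF w, of t0 t 1 L] by simp
  ultimately have "\<psi> k L t0 2 t = L powr (-1/2) * ((t - t0) * cos (\<omega> k L * (t0 + L)) / \<omega> k L
      + sin (\<omega> k L * (t0 + L)) / (\<omega> k L)\<^sup>2) - \<psi> k L t0 0 t / (\<omega> k L)\<^sup>2"
    by (simp add: right_diff_distrib)
  then show ?thesis
    by (simp add: 0 distrib_left mult_ac)
next
  case (Suc j)
  \<comment> \<open>\<open>A\<close> and \<open>B\<close> are the integrals behind orders
    \<open>n\<close> and \<open>n + 2\<close>. The exponent of \<open>B\<close> is at least 2, so
    both boundary terms at \<open>u = t\<close> vanish.\<close>
  define A where "A = (LBINT u=t0..t. (t - u) ^ j * sin (\<omega> k L * (u + L)))"
  define B where "B = (LBINT u=t0..t. (t - u) ^ (j + 2) * sin (\<omega> k L * (u + L)))"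
  define x y where "x = (t - t0) ^ (j + 2) * cos (\<omega> k L * (t0 + L))"
    and "y = (t - t0) ^ (j + 1) * sin (\<omega> k L * (t0 + L))"
  \<comment> \<open>With the factorials split into nonzero atoms, the factor \<open>q * p\<close> in
    front of \<open>A\<close> cancels visibly against \<open>fact (j + 2)\<close>.\<close>
  define p q F where "p = real j + 1" and "q = real j + 2" and "F = (fact j :: real)"
  have fact: "(fact (j + 1) :: real) = p * F" "(fact (j + 2) :: real) = q * p * F"
    by (simp_all add: p_def q_def F_def algebra_simps)
  have nz: "p \<noteq> 0" "q \<noteq> 0" "F \<noteq> 0"
    by (simp_all add: p_def q_def F_def add_eq_0_iff)
  have B: "B = x / \<omega> k L + q * y / (\<omega> k L)\<^sup>2 - q * p / (\<omega> k L)\<^sup>2 * A"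
    using integral_power_sin_step[OF w, of t0 t "j + 2" L]
    unfolding A_def B_def x_def y_def p_def q_def by (simp add: algebra_simps)
  have l: "\<psi> k L t0 (int (n + 2)) t = L powr (-1/2) / fact (j + 2) * B"
    using \<psi>_pos[of k L t0 "j + 2" t] by (simp add: B_def Suc)
  have r: "\<psi> k L t0 (int n) t = L powr (-1/2) / F * A"
    using \<psi>_pos[of k L t0 j t] by (simp add: A_def F_def Suc)
  have "L powr (-1/2) / (q * p * F) * B
      = x * L powr (-1/2) / (q * p * F * \<omega> k L) + y * L powr (-1/2) / (p * F * (\<omega> k L)\<^sup>2)
        - L powr (-1/2) / F * A / (\<omega> k L)\<^sup>2"
    unfolding B using nz w by (simp add: distrib_left right_diff_distrib mult_ac)
  then show ?thesis
    unfolding l r fact[symmetric] by (simp add: x_def y_def Suc mult_ac del: fact_Suc)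
qed

theorem proposition2:
  fixes L t0 t1 :: real and k :: nat and m :: int
  assumes "L > 0"
    and "t0 \<le> t1" and "{t0..t1} \<subseteq> {-L..L}"
    and "k \<ge> 1"
  shows "\<forall>t\<in>{t0..t1}.
    (m \<le> 0 \<longrightarrow>
      \<psi> k L t0 m t =
        L powr (-1/2) * \<omega> k L powi (- m) * sin (\<omega> k L * (t + L) - of_int m * pi / 2)) \<and>
    (m = 1 \<longrightarrow>
      \<psi> k L t0 m t =
        L powr (-1/2) / \<omega> k L * (cos (\<omega> k L * (t0 + L)) - cos (\<omega> k L * (t + L)))) \<and>
    (m \<ge> 2 \<longrightarrow>
      \<psi> k L t0 m t =
        (t - t0) ^ nat (m - 1) * L powr (-1/2) / (fact (nat (m - 1)) * \<omega> k L)
          * cos (\<omega> k L * (t0 + L))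
        + (t - t0) ^ nat (m - 2) * L powr (-1/2) / (fact (nat (m - 2)) * (\<omega> k L)\<^sup>2)
          * sin (\<omega> k L * (t0 + L))
        - \<omega> k L powi (-2) * \<psi> k L t0 (m - 2) t)"
proof (intro ballI conjI impI)
  fix t
  have w: "\<omega> k L \<noteq> 0"
    using assms by (simp add: \<omega>_def)
  show "\<psi> k L t0 m t =
      L powr (-1/2) * \<omega> k L powi (- m) * sin (\<omega> k L * (t + L) - of_int m * pi / 2)"
    if "m \<le> 0"
  proof -
    obtain n where "m = - int n"
      using nonpos_int_cases[OF \<open>m \<le> 0\<close>] by blast
    then show ?thesis
      by (simp add: \<psi>_nonpos power_int_def)
  qed
  show "\<psi> k L t0 m t =
      L powr (-1/2) / \<omega> k L * (cos (\<omega> k L * (t0 + L)) - cos (\<omega> k L * (t + L)))"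
    if "m = 1"
    using \<psi>_one[OF w] that by simp
  show "\<psi> k L t0 m t =
      (t - t0) ^ nat (m - 1) * L powr (-1/2) / (fact (nat (m - 1)) * \<omega> k L)
        * cos (\<omega> k L * (t0 + L))
      + (t - t0) ^ nat (m - 2) * L powr (-1/2) / (fact (nat (m - 2)) * (\<omega> k L)\<^sup>2)
        * sin (\<omega> k L * (t0 + L))
      - \<omega> k L powi (-2) * \<psi> k L t0 (m - 2) t"
    if "m \<ge> 2"
  proof -
    \<comment> \<open>Since \<open>m \<ge> 2\<close>, no truncation occurs:
      \<open>nat (m - 1)\<close> is \<open>n + 1\<close>, and \<open>m - 2\<close> is a nonnegative
      order, as the recurrence requires.\<close>
    define n where "n = nat (m - 2)"
    have n: "m = int (n + 2)" "nat (m - 1) = n + 1" "nat (m - 2) = n" "m - 2 = int n"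
      using that by (simp_all add: n_def)
    have "\<omega> k L powi (-2) = 1 / (\<omega> k L)\<^sup>2"
      by (simp add: power_int_def field_simps)
    then show ?thesis
      unfolding n(2-4) using \<psi>_recurrence[OF w, of t0 n t] n(1) by simp
  qed
qed

end
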